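(* Let $P$ be a locally finite poset. Then the following implications hold for $P$ (the meaning of "etc." is given in the context): (a) (VT) and (NCC) imply (UT). (b) (VT) and (DAI) imply (D$3^-$C). (c) (VT) and (NTC) imply (D$3^-$C). (d) (VT) and (SS) imply (D$3^-$C). (e) (VT) and (FT) imply (D$3^-$C) and (D3MF). (f) (D$3^-$C) and (UT) imply (DAI). (g) (D$3^-$C) and (NCC) imply (UT), (DAI), and (UC3). (h) (D$3^-$C), (D3MD), and (NTC) imply (NCC), etc. (i) (D3MF) and (NCC) imply (D3MD). (j) (D3MF) and (DAI) imply (FT). (k) (D$3^-$CF) and (UC3) imply (D$3^-$C) and (D3MF). (l) (D$3^-$CF) and (NCC) imply (D3MF), (D3MD), etc. (m) (D$3^-$CF) and (D3MD) imply (NCC), (D3MF), etc. (n) (D$3^-$C), (D3MF), and (NCC) imply (VT) and (FT), etc. (o) (VT) implies (UPUE).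
   Context: All posets are locally finite (every closed interval is finite). In the list of implications (a)–(o), an entry "etc." among the conclusions of a part indicates that further conclusions may be drawn by using one or both of the conclusions listed in that part to satisfy the hypotheses of an earlier part of the list. Write $x\rightarrow y$ when $y$ covers $x$; $\{x,y\}\rightarrow z$ means $x\to z$ and $y\to z$; $w\to\{x,y\}$ means $w\to x$ and $w\to y$. Letters $u,w,w',x,y,z$ in sets below denote distinct elements. A diamond is a set $\{w;x,y;z\}$ with $w\to\{x,y\}$ and $\{x,y\}\to z$; its bottom is $w$, its top is $z$, its elbows are $x,y$. An interval $[w,z]$ is a $d_3$-interval if it is a diamond $\{w;x,y;z\}$ for some $x,y$. A vee, or $d_3^-$-set, is a set $\{w;x,y\}$ with $w\to\{x,y\}$. A top of such a vee is an element $z$ with $\{x,y\}\to z$; a completing element is a $z$ such that $\{w;x,y;z\}$ is a $d_3$-interval. Two $d_3^-$-sets $\{w;x,y\}$ and $\{w';x,y\}$ with $w\ne w'$ overlap. Two $d_3$-intervals are distinct if they differ as sets. An interval $[w,z]$ is short if there is $u$ with $w\to u\to z$. Axioms: (VT) $w\to\{x,y\}$ implies there is $z$ with $\{x,y\}\to z$. (D$3^-$C) for each $d_3^-$-set $S$ there is $z$ such that $S\cup\{z\}$ is a $d_3$-interval. (FT) the top of each diamond covers only the elbows of the diamond. (D3MF) the maximum element of each $d_3$-interval covers only the elbows of the interval. (D$3^-$CF) for each $d_3^-$-set $S$ there is $z$ such that $S\cup\{z\}$ is a $d_3$-interval with maximum element $z$ and $z$ covers only elements of $S$. (NCC) there do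 not exist overlapping $d_3^-$-sets. (D3MD) the maximum elements of distinct $d_3$-intervals are distinct. Properties: (UPUE) $w\le y$, $w\to x$, $x\not\le y$ imply there is $z$ with $y\to z$ and $x\le z$. (SS) whenever $[w,z]$ is a short interval, $|[w,z]|\in\{3,4\}$. (DAI) each diamond $\{w;x,y;z\}$ is an interval, i.e. equals $[w,z]$. (NTC) no element is covered by three (distinct) elements. (UT) each vee has exactly one top. (UC3) each $d_3^-$-set has exactly one completing element. *)

theory Defs
  imports Main
begin

text \<open>
  A poset is a carrier set \<open>P\<close> with a relation \<open>r\<close> such that \<open>partial_order_on P r\<close>, where
  \<open>(x, y) \<in> r\<close> means \<open>x \<le> y\<close>.  As \<open>r \<subseteq> P \<times> P\<close>, every element that is related to some element
  lies in \<open>P\<close>; hence the notions below need only \<open>r\<close>, and their quantifiers need no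
  relativisation to \<open>P\<close>.
\<close>

definition interval :: "'a rel \<Rightarrow> 'a \<Rightarrow> 'a \<Rightarrow> 'a set" where
  "interval r w z = {u. (w, u) \<in> r \<and> (u, z) \<in> r}"

definition locally_finite_poset :: "'a set \<Rightarrow> 'a rel \<Rightarrow> bool" where
  "locally_finite_poset P r \<longleftrightarrow>
     partial_order_on P r \<and> (\<forall>w\<in>P. \<forall>z\<in>P. finite (interval r w z))"

text \<open>\<open>cov r x y\<close> is \<open>x \<rightarrow> y\<close>, that is, \<open>y\<close> covers \<open>x\<close>.\<close>

definition cov :: "'a rel \<Rightarrow> 'a \<Rightarrow> 'a \<Rightarrow> bool" where
  "cov r x y \<longleftrightarrow>
     (x, y) \<in> r \<and> x \<noteq> y \<and> (\<forall>u. (x, u) \<in> r \<and> (u, y) \<in> r \<longrightarrow> u = x \<or> u = y)"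

text \<open>
  Diamonds and vees are given by their labelled elements \<open>{w; x, y; z}\<close> and \<open>{w; x, y}\<close>.
  Labels denote distinct elements; only \<open>x \<noteq> y\<close> does not already follow from the coverings.
\<close>

definition vee :: "'a rel \<Rightarrow> 'a \<Rightarrow> 'a \<Rightarrow> 'a \<Rightarrow> bool" where
  "vee r w x y \<longleftrightarrow> x \<noteq> y \<and> cov r w x \<and> cov r w y"

definition is_top :: "'a rel \<Rightarrow> 'a \<Rightarrow> 'a \<Rightarrow> 'a \<Rightarrow> bool" where
  "is_top r x y z \<longleftrightarrow> cov r x z \<and> cov r y z"

definition diamond :: "'a rel \<Rightarrow> 'a \<Rightarrow> 'a \<Rightarrow> 'a \<Rightarrow> 'a \<Rightarrow> bool" where
  "diamond r w x y z \<longleftrightarrow> vee r w x y \<and> is_top r x y z"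

text \<open>
  \<open>{w; x, y; z}\<close> is a \<open>d\<^sub>3\<close>-interval; equivalently \<open>z\<close> is a completing element of the vee
  \<open>{w; x, y}\<close>.  The maximum element of such an interval is \<open>z\<close>.
\<close>

definition d3_interval :: "'a rel \<Rightarrow> 'a \<Rightarrow> 'a \<Rightarrow> 'a \<Rightarrow> 'a \<Rightarrow> bool" where
  "d3_interval r w x y z \<longleftrightarrow> diamond r w x y z \<and> interval r w z = {w, x, y, z}"

definition short_interval :: "'a rel \<Rightarrow> 'a \<Rightarrow> 'a \<Rightarrow> bool" where
  "short_interval r w z \<longleftrightarrow> (\<exists>u. cov r w u \<and> cov r u z)"

text \<open>
  In the names of the axioms, \<open>D3m\<close> stands for \<open>D3\<^sup>-\<close>.
  Where a part of the theorem ends in ``etc.'', its conclusion also lists everything that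
  follows from its hypotheses and its displayed conclusions by (repeatedly) applying earlier parts,
  with the immediate implications from \<open>D3mCF\<close> to \<open>D3mC\<close> and from \<open>D3mC\<close> to \<open>VT\<close>
  allowed when matching hypotheses.
\<close>

definition VT :: "'a rel \<Rightarrow> bool" where
  "VT r \<longleftrightarrow> (\<forall>w x y. vee r w x y \<longrightarrow> (\<exists>z. is_top r x y z))"

definition D3mC :: "'a rel \<Rightarrow> bool" where
  "D3mC r \<longleftrightarrow> (\<forall>w x y. vee r w x y \<longrightarrow> (\<exists>z. d3_interval r w x y z))"

definition FT :: "'a rel \<Rightarrow> bool" where
  "FT r \<longleftrightarrow> (\<forall>w x y z. diamond r w x y z \<longrightarrow> (\<forall>u. cov r u z \<longrightarrow> u \<in> {x, y}))"

definition D3MF :: "'a rel \<Rightarrow> bool" where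
  "D3MF r \<longleftrightarrow> (\<forall>w x y z. d3_interval r w x y z \<longrightarrow> (\<forall>u. cov r u z \<longrightarrow> u \<in> {x, y}))"

definition D3mCF :: "'a rel \<Rightarrow> bool" where
  "D3mCF r \<longleftrightarrow> (\<forall>w x y. vee r w x y \<longrightarrow>
     (\<exists>z. d3_interval r w x y z \<and> (\<forall>u. cov r u z \<longrightarrow> u \<in> {w, x, y})))"

definition NCC :: "'a rel \<Rightarrow> bool" where
  "NCC r \<longleftrightarrow> \<not> (\<exists>w w' x y. w \<noteq> w' \<and> vee r w x y \<and> vee r w' x y)"

definition D3MD :: "'a rel \<Rightarrow> bool" where
  "D3MD r \<longleftrightarrow> (\<forall>w x y z w' x' y' z'.
     d3_interval r w x y z \<and> d3_interval r w' x' y' z' \<and> {w, x, y, z} \<noteq> {w', x', y', z'}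
     \<longrightarrow> z \<noteq> z')"

definition UPUE :: "'a rel \<Rightarrow> bool" where
  "UPUE r \<longleftrightarrow> (\<forall>w x y. (w, y) \<in> r \<and> cov r w x \<and> (x, y) \<notin> r
     \<longrightarrow> (\<exists>z. cov r y z \<and> (x, z) \<in> r))"

definition SS :: "'a rel \<Rightarrow> bool" where
  "SS r \<longleftrightarrow> (\<forall>w z. short_interval r w z \<longrightarrow> card (interval r w z) \<in> {3, 4})"

definition DAI :: "'a rel \<Rightarrow> bool" where
  "DAI r \<longleftrightarrow> (\<forall>w x y z. diamond r w x y z \<longrightarrow> interval r w z = {w, x, y, z})"

definition NTC :: "'a rel \<Rightarrow> bool" where
  "NTC r \<longleftrightarrow> \<not> (\<exists>w x y z. x \<noteq> y \<and> x \<noteq> z \<and> y \<noteq> z \<and> cov r w x \<and> cov r w y \<and> cov r w z)"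

definition UT :: "'a rel \<Rightarrow> bool" where
  "UT r \<longleftrightarrow> (\<forall>w x y. vee r w x y \<longrightarrow> (\<exists>!z. is_top r x y z))"

definition UC3 :: "'a rel \<Rightarrow> bool" where
  "UC3 r \<longleftrightarrow> (\<forall>w x y. vee r w x y \<longrightarrow> (\<exists>!z. d3_interval r w x y z))"

end

theory Submission
  imports Defs
begin

text \<open>
  A diamond \<open>{w; x, y; z}\<close> fails to be an interval only if some \<open>u\<close> lies strictly between \<open>w\<close> and
  \<open>z\<close> off the elbows. By local finiteness such a \<open>u\<close> yields both a third cover of \<open>w\<close> below it and
  a third element covered by \<open>z\<close> above it. So a diamond is an interval as soon as its bottom has no
  third cover, or its top covers only the elbows. Two tops of one vee give overlapping vees one
  level up, so (NCC) makes tops unique.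
  For (UPUE), climb from \<open>w\<close> to \<open>y\<close> along covers and push \<open>x\<close> up with (VT).
\<close>

section \<open>Finite intervals, duality and the existence of covers\<close>

lemma locally_finite_poset_refl:
  "locally_finite_poset P r \<Longrightarrow> (x, y) \<in> r \<Longrightarrow> (x, x) \<in> r \<and> (y, y) \<in> r"
  unfolding locally_finite_poset_def partial_order_on_def preorder_on_def refl_on_def by blast

lemma locally_finite_poset_trans:
  "locally_finite_poset P r \<Longrightarrow> (x, y) \<in> r \<Longrightarrow> (y, z) \<in> r \<Longrightarrow> (x, z) \<in> r"
  unfolding locally_finite_poset_def partial_order_on_def preorder_on_def trans_def by blast

lemma locally_finite_poset_antisym:
  "locally_finite_poset P r \<Longrightarrow> (x, y) \<in> r \<Longrightarrow> (y, x) \<in> r \<Longrightarrow> x = y"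
  unfolding locally_finite_poset_def partial_order_on_def antisym_def by blast

text \<open>Local finiteness speaks only of endpoints in \<open>P\<close>, but a nonempty interval
  has both its endpoints there.\<close>

lemma finite_interval:
  assumes "locally_finite_poset P r"
  shows "finite (interval r w z)"
proof (cases "interval r w z = {}")
  case False
  then obtain u where "(w, u) \<in> r" "(u, z) \<in> r"
    unfolding interval_def by blast
  then have "w \<in> P" "z \<in> P"
    using assms
    unfolding locally_finite_poset_def partial_order_on_def preorder_on_def refl_on_def by auto
  then show ?thesis
    using assms unfolding locally_finite_poset_def by blast
qed simp

lemma interval_converse: "interval (r\<inverse>) z w = interval r w z"
  unfolding interval_def by auto

lemma cov_converse: "cov (r\<inverse>) y x \<longleftrightarrow> cov r x y"
  unfolding cov_def by auto

text \<open>Together with the two preceding facts this gives duality: what is shown about upper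
  covers and lower endpoints transfers to lower covers and upper endpoints.\<close>

lemma locally_finite_poset_converse:
  "locally_finite_poset P r \<Longrightarrow> locally_finite_poset P (r\<inverse>)"
  unfolding locally_finite_poset_def
  by (auto simp: interval_converse partial_order_on_def preorder_on_def)

text \<open>Supplies the decreasing measure for the inductions below; by antisymmetry
  \<open>w\<close> itself drops out of the interval.\<close>

lemma card_interval_less:
  assumes P: "locally_finite_poset P r"
    and r: "(w, v) \<in> r" "w \<noteq> v" "(v, z) \<in> r"
  shows "card (interval r v z) < card (interval r w z)"
proof (rule psubset_card_mono[OF finite_interval[OF P]])
  have "(w, w) \<in> r" "(w, z) \<in> r"
    using locally_finite_poset_refl[OF P] locally_finite_poset_trans[OF P] r by blast+
  moreover have "(v, w) \<notin> r"
    using locally_finite_poset_antisym[OF P] r by blast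
  ultimately show "interval r v z \<subset> interval r w z"
    using locally_finite_poset_trans[OF P] r unfolding interval_def by blast
qed

text \<open>If \<open>z\<close> does not cover \<open>w\<close>, some \<open>u\<close> lies strictly
  between them. By the dual of \<open>card_interval_less\<close>, \<open>[w,u]\<close> is smaller
  than \<open>[w,z]\<close>, and a cover of \<open>w\<close> below \<open>u\<close> is also below
  \<open>z\<close>.\<close>

lemma obtain_cov_above:
  assumes P: "locally_finite_poset P r" and "(w, z) \<in> r" "w \<noteq> z"
  obtains a where "cov r w a" "(a, z) \<in> r"
  using assms(2,3)
proof (induction "card (interval r w z)" arbitrary: z thesis rule: less_induct)
  case less
  show ?case
  proof (cases "cov r w z")
    case True
    then show ?thesis
      using less.prems locally_finite_poset_refl[OF P] by blast
  next
    case False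
    then obtain u where u: "(w, u) \<in> r" "(u, z) \<in> r" "u \<noteq> w" "u \<noteq> z"
      using less.prems unfolding cov_def by blast
    have "card (interval r w u) < card (interval r w z)"
      using card_interval_less[OF locally_finite_poset_converse[OF P], of z u w] u
      by (simp add: interval_converse)
    then obtain a where "cov r w a" "(a, u) \<in> r"
      using less.hyps u by metis
    then show ?thesis
      using less.prems locally_finite_poset_trans[OF P] u by blast
  qed
qed

lemma obtain_cov_below:
  assumes P: "locally_finite_poset P r" and "(w, z) \<in> r" "w \<noteq> z"
  obtains c where "cov r c z" "(w, c) \<in> r"
  using obtain_cov_above[OF locally_finite_poset_converse[OF P], of z w] assms(2,3)
  by (auto simp: cov_converse)

section \<open>Diamonds that are intervals\<close>

lemma diamond_subset_interval:
  assumes P: "locally_finite_poset P r" and d: "diamond r w x y z"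
  shows "{w, x, y, z} \<subseteq> interval r w z"
  using d locally_finite_poset_trans[OF P] locally_finite_poset_refl[OF P]
  unfolding diamond_def vee_def is_top_def cov_def interval_def by blast

lemma diamond_distinct:
  assumes P: "locally_finite_poset P r" and d: "diamond r w x y z"
  shows "w \<noteq> x" "w \<noteq> y" "x \<noteq> y" "x \<noteq> z" "y \<noteq> z" "w \<noteq> z"
  using d locally_finite_poset_antisym[OF P]
  unfolding diamond_def vee_def is_top_def cov_def by blast+

lemma diamond_interior_covs:
  assumes P: "locally_finite_poset P r" and d: "diamond r w x y z"
    and u: "u \<in> interval r w z" "u \<notin> {w, x, y, z}"
  obtains a c where "cov r w a" "a \<notin> {x, y}" "cov r c z" "c \<notin> {x, y}"
proof -
  have wu: "(w, u) \<in> r" "w \<noteq> u" and uz: "(u, z) \<in> r" "u \<noteq> z"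
    using u unfolding interval_def by auto
  obtain a where a: "cov r w a" "(a, u) \<in> r"
    using obtain_cov_above[OF P wu] .
  obtain c where c: "cov r c z" "(u, c) \<in> r"
    using obtain_cov_below[OF P uz] .
  \<comment> \<open>If \<open>a\<close> were an elbow, \<open>u\<close> would lie strictly between
    that elbow and \<open>z\<close>; if \<open>c\<close> were one, \<open>u\<close> would lie
    strictly between \<open>w\<close> and it.\<close>
  have "a \<notin> {x, y}" "c \<notin> {x, y}"
    using d u a(2) c(2) wu(1) uz(1)
    unfolding diamond_def vee_def is_top_def cov_def by auto
  with a c show ?thesis
    using that by blast
qed

lemma d3_interval_if_bottom:
  assumes P: "locally_finite_poset P r" and d: "diamond r w x y z"
    and "\<And>a. cov r w a \<Longrightarrow> a \<in> {x, y}"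
  shows "d3_interval r w x y z"
  using diamond_interior_covs[OF P d] diamond_subset_interval[OF P d] d assms(3)
  unfolding d3_interval_def by blast

lemma d3_interval_if_top:
  assumes P: "locally_finite_poset P r" and d: "diamond r w x y z"
    and "\<And>c. cov r c z \<Longrightarrow> c \<in> {x, y}"
  shows "d3_interval r w x y z"
  using diamond_interior_covs[OF P d] diamond_subset_interval[OF P d] d assms(3)
  unfolding d3_interval_def by blast

lemma d3_interval_imp_diamond: "d3_interval r w x y z \<Longrightarrow> diamond r w x y z"
  unfolding d3_interval_def by blast

text \<open>The elbows lie strictly between. This removes \<open>w\<close> from the set
  \<open>{w, x, y}\<close> that \<open>D3mCF\<close> allows.\<close>

lemma not_cov_bottom_top: "diamond r w x y z \<Longrightarrow> \<not> cov r w z"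
  unfolding diamond_def vee_def is_top_def cov_def by metis

text \<open>A common top forces equal element sets under \<open>D3MD\<close>, and the bottom is the
  one element left after removing elbows and top.\<close>

lemma D3MD_same_bottom:
  assumes P: "locally_finite_poset P r" and "D3MD r"
    and d: "d3_interval r w x y z" "d3_interval r w' x y z"
  shows "w = w'"
proof -
  have "{w, x, y, z} = {w', x, y, z}"
    using assms(2) d unfolding D3MD_def by blast
  then show ?thesis
    using diamond_distinct[OF P d3_interval_imp_diamond[OF d(1)]]
      diamond_distinct[OF P d3_interval_imp_diamond[OF d(2)]] by blast
qed

section \<open>Implications among the axioms and properties\<close>

lemma D3mCF_imp_D3mC: "D3mCF r \<Longrightarrow> D3mC r"
  unfolding D3mCF_def D3mC_def by blast

lemma D3mC_imp_VT: "D3mC r \<Longrightarrow> VT r"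
  unfolding VT_def D3mC_def d3_interval_def diamond_def by blast

lemma VT_NCC_imp_UT:
  assumes "VT r" "NCC r"
  shows "UT r"
  unfolding UT_def
proof (intro allI impI)
  fix w x y
  assume v: "vee r w x y"
  have "z = z'" if "is_top r x y z" "is_top r x y z'" for z z'
    using that v \<open>NCC r\<close> unfolding NCC_def vee_def is_top_def by blast
  with v \<open>VT r\<close> show "\<exists>!z. is_top r x y z"
    unfolding VT_def by blast
qed

lemma VT_DAI_imp_D3mC: "VT r \<Longrightarrow> DAI r \<Longrightarrow> D3mC r"
  unfolding VT_def DAI_def D3mC_def d3_interval_def diamond_def by blast

lemma diamond_NTC_imp_d3_interval:
  assumes P: "locally_finite_poset P r" and "NTC r" and d: "diamond r w x y z"
  shows "d3_interval r w x y z"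
  using d3_interval_if_bottom[OF P d] d \<open>NTC r\<close>
  unfolding NTC_def diamond_def vee_def by blast

lemma VT_NTC_imp_D3mC:
  assumes "locally_finite_poset P r" "VT r" "NTC r"
  shows "D3mC r"
  using diamond_NTC_imp_d3_interval[OF assms(1,3)] assms(2)
  unfolding VT_def D3mC_def diamond_def by blast

text \<open>The diamond already fills its interval, having four distinct elements where
  \<open>SS\<close> allows at most four.\<close>

lemma diamond_SS_imp_d3_interval:
  assumes P: "locally_finite_poset P r" and "SS r" and d: "diamond r w x y z"
  shows "d3_interval r w x y z"
proof -
  have "short_interval r w z"
    using d unfolding short_interval_def diamond_def vee_def is_top_def by blast
  then have "card (interval r w z) \<le> 4"
    using \<open>SS r\<close> unfolding SS_def by force
  moreover have "card {w, x, y, z} = 4"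
    using diamond_distinct[OF P d] by simp
  ultimately have "{w, x, y, z} = interval r w z"
    using card_seteq[OF finite_interval[OF P] diamond_subset_interval[OF P d]] by simp
  with d show ?thesis
    unfolding d3_interval_def by simp
qed

lemma VT_SS_imp_D3mC:
  assumes "locally_finite_poset P r" "VT r" "SS r"
  shows "D3mC r"
  using diamond_SS_imp_d3_interval[OF assms(1,3)] assms(2)
  unfolding VT_def D3mC_def diamond_def by blast

lemma FT_imp_D3MF: "FT r \<Longrightarrow> D3MF r"
  unfolding FT_def D3MF_def d3_interval_def by blast

lemma VT_FT_imp_D3mC:
  assumes P: "locally_finite_poset P r" and "VT r" "FT r"
  shows "D3mC r"
  unfolding D3mC_def
proof (intro allI impI)
  fix w x y
  assume "vee r w x y"
  then obtain z where d: "diamond r w x y z"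
    using \<open>VT r\<close> unfolding VT_def diamond_def by blast
  then show "\<exists>z. d3_interval r w x y z"
    using d3_interval_if_top[OF P d] \<open>FT r\<close> unfolding FT_def by blast
qed

text \<open>A completing element is a top, so by uniqueness the top of any diamond is the completing
  element of its vee.\<close>

lemma D3mC_UT_imp_DAI: "D3mC r \<Longrightarrow> UT r \<Longrightarrow> DAI r"
  unfolding D3mC_def UT_def DAI_def d3_interval_def diamond_def by metis

lemma D3mC_UT_imp_UC3: "D3mC r \<Longrightarrow> UT r \<Longrightarrow> UC3 r"
  unfolding D3mC_def UT_def UC3_def d3_interval_def diamond_def by metis

lemma D3mC_NCC_imp:
  assumes "D3mC r" "NCC r"
  shows "UT r" "DAI r" "UC3 r"
proof -
  show "UT r"
    using VT_NCC_imp_UT D3mC_imp_VT assms by blast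
  then show "DAI r" "UC3 r"
    using D3mC_UT_imp_DAI D3mC_UT_imp_UC3 assms by blast+
qed

text \<open>A completing element of one of two overlapping vees is a top of the other.
  \<open>NTC\<close> makes both diamonds intervals, and \<open>D3MD\<close> then identifies their
  bottoms.\<close>

lemma D3mC_D3MD_NTC_imp_NCC:
  assumes P: "locally_finite_poset P r" and "D3mC r" "D3MD r" "NTC r"
  shows "NCC r"
proof -
  have "w = w'" if v: "vee r w x y" "vee r w' x y" for w w' x y
  proof -
    obtain z where z: "d3_interval r w x y z"
      using \<open>D3mC r\<close> v unfolding D3mC_def by blast
    then have "diamond r w' x y z"
      using v unfolding d3_interval_def diamond_def by blast
    then show "w = w'"
      using diamond_NTC_imp_d3_interval[OF P \<open>NTC r\<close>] D3MD_same_bottom[OF P \<open>D3MD r\<close> z] by blast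
  qed
  then show ?thesis
    unfolding NCC_def by blast
qed

text \<open>If two intervals share their top, \<open>D3MF\<close> makes their elbows agree up to
  order, and \<open>NCC\<close> then makes their bottoms agree.\<close>

lemma D3MF_NCC_imp_D3MD:
  assumes "D3MF r" "NCC r"
  shows "D3MD r"
proof -
  have "{w, x, y, z} = {w', x', y', z}"
    if d: "d3_interval r w x y z" "d3_interval r w' x' y' z" for w x y z w' x' y'
  proof -
    have "x' \<in> {x, y}" "y' \<in> {x, y}"
      using \<open>D3MF r\<close> d unfolding D3MF_def d3_interval_def diamond_def is_top_def by blast+
    moreover have "x' \<noteq> y'"
      using d unfolding d3_interval_def diamond_def vee_def by blast
    ultimately have "x' = x \<and> y' = y \<or> x' = y \<and> y' = x"
      by blast
    moreover from this have "w = w'"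
      using d \<open>NCC r\<close> unfolding NCC_def d3_interval_def diamond_def vee_def by metis
    ultimately show ?thesis
      by auto
  qed
  then show ?thesis
    unfolding D3MD_def by blast
qed

lemma D3MF_DAI_imp_FT: "D3MF r \<Longrightarrow> DAI r \<Longrightarrow> FT r"
  unfolding D3MF_def DAI_def FT_def d3_interval_def by blast

lemma D3mCF_UC3_imp_D3MF:
  assumes "D3mCF r" "UC3 r"
  shows "D3MF r"
  unfolding D3MF_def
proof (intro allI impI)
  fix w x y z u
  assume z: "d3_interval r w x y z" and u: "cov r u z"
  then have v: "vee r w x y"
    unfolding d3_interval_def diamond_def by blast
  \<comment> \<open>By \<open>UC3\<close>, \<open>z\<close> is the very completing element that
    \<open>D3mCF\<close> provides.\<close>
  then have "u \<in> {w, x, y}"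
    using z u assms unfolding D3mCF_def UC3_def by metis
  then show "u \<in> {x, y}"
    using not_cov_bottom_top[OF d3_interval_imp_diamond[OF z]] u by blast
qed

text \<open>As in \<open>D3mC_D3MD_NTC_imp_NCC\<close>, but the second diamond is an interval
  because the chosen top covers only the elbows.\<close>

lemma D3mCF_D3MD_imp_NCC:
  assumes P: "locally_finite_poset P r" and "D3mCF r" "D3MD r"
  shows "NCC r"
proof -
  have "w = w'" if v: "vee r w x y" "vee r w' x y" for w w' x y
  proof -
    obtain z where z: "d3_interval r w x y z" "\<And>u. cov r u z \<Longrightarrow> u \<in> {w, x, y}"
      using \<open>D3mCF r\<close> v unfolding D3mCF_def by blast
    have "diamond r w' x y z"
      using z v unfolding d3_interval_def diamond_def by blast
    moreover have "u \<in> {x, y}" if "cov r u z" for u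
      using z that not_cov_bottom_top[OF d3_interval_imp_diamond[OF z(1)]] by blast
    ultimately show "w = w'"
      using d3_interval_if_top[OF P] D3MD_same_bottom[OF P \<open>D3MD r\<close> z(1)] by blast
  qed
  then show ?thesis
    unfolding NCC_def by blast
qed

section \<open>The exchange property \<open>UPUE\<close>\<close>

lemma VT_imp_UPUE:
  assumes P: "locally_finite_poset P r" and "VT r"
  shows "UPUE r"
proof -
  have "\<exists>z. cov r y z \<and> (x, z) \<in> r" if "(w, y) \<in> r" "cov r w x" "(x, y) \<notin> r" for w x y
    using that
  proof (induction "card (interval r w y)" arbitrary: w x rule: less_induct)
    case less
    show ?case
    proof (cases "w = y")
      case True
      \<comment> \<open>Here \<open>x\<close> itself is the required cover of
        \<open>y\<close>.\<close>
      then show ?thesis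
        using less.prems locally_finite_poset_refl[OF P] unfolding cov_def by blast
    next
      case False
      then obtain v where v: "cov r w v" "(v, y) \<in> r"
        using obtain_cov_above[OF P] less.prems by blast
      \<comment> \<open>\<open>v\<close> differs from \<open>x\<close> because only \<open>v\<close>
        lies below \<open>y\<close>.\<close>
      then have "vee r w x v"
        using less.prems unfolding vee_def by blast
      then obtain t where t: "cov r x t" "cov r v t"
        using \<open>VT r\<close> unfolding VT_def is_top_def by blast
      then have xt: "(x, t) \<in> r"
        unfolding cov_def by blast
      \<comment> \<open>Since \<open>x\<close> is below \<open>t\<close>, the pair \<open>v\<close>,
        \<open>t\<close> inherits the hypotheses on \<open>w\<close>, \<open>x\<close>, and the
        induction continues on \<open>[v,y]\<close>.\<close>
      then have "(t, y) \<notin> r"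
        using locally_finite_poset_trans[OF P] less.prems by blast
      moreover have "card (interval r v y) < card (interval r w y)"
        using card_interval_less[OF P] v unfolding cov_def by blast
      ultimately obtain z where "cov r y z" "(t, z) \<in> r"
        using less.hyps v t by blast
      then show ?thesis
        using locally_finite_poset_trans[OF P xt] by blast
    qed
  qed
  then show ?thesis
    unfolding UPUE_def by blast
qed

theorem theorem4p1:
  fixes P :: "'a set" and r :: "'a rel"
  assumes "locally_finite_poset P r"
  shows "(VT r \<and> NCC r \<longrightarrow> UT r)
    \<and> (VT r \<and> DAI r \<longrightarrow> D3mC r)
    \<and> (VT r \<and> NTC r \<longrightarrow> D3mC r)
    \<and> (VT r \<and> SS r \<longrightarrow> D3mC r)
    \<and> (VT r \<and> FT r \<longrightarrow> D3mC r \<and> D3MF r)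
    \<and> (D3mC r \<and> UT r \<longrightarrow> DAI r)
    \<and> (D3mC r \<and> NCC r \<longrightarrow> UT r \<and> DAI r \<and> UC3 r)
    \<and> (D3mC r \<and> D3MD r \<and> NTC r \<longrightarrow> NCC r \<and> UT r \<and> DAI r \<and> UC3 r)
    \<and> (D3MF r \<and> NCC r \<longrightarrow> D3MD r)
    \<and> (D3MF r \<and> DAI r \<longrightarrow> FT r)
    \<and> (D3mCF r \<and> UC3 r \<longrightarrow> D3mC r \<and> D3MF r)
    \<and> (D3mCF r \<and> NCC r \<longrightarrow>
         D3MF r \<and> D3MD r \<and> D3mC r \<and> UT r \<and> DAI r \<and> UC3 r \<and> FT r)
    \<and> (D3mCF r \<and> D3MD r \<longrightarrow>
         NCC r \<and> D3MF r \<and> D3mC r \<and> UT r \<and> DAI r \<and> UC3 r \<and> FT r)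
    \<and> (D3mC r \<and> D3MF r \<and> NCC r \<longrightarrow>
         VT r \<and> FT r \<and> UT r \<and> DAI r \<and> UC3 r \<and> D3MD r)
    \<and> (VT r \<longrightarrow> UPUE r)"
proof -
  note P = assms
  have a: "VT r \<and> NCC r \<longrightarrow> UT r"
    using VT_NCC_imp_UT by blast
  have b: "VT r \<and> DAI r \<longrightarrow> D3mC r"
    using VT_DAI_imp_D3mC by blast
  have c: "VT r \<and> NTC r \<longrightarrow> D3mC r"
    using VT_NTC_imp_D3mC[OF P] by blast
  have d: "VT r \<and> SS r \<longrightarrow> D3mC r"
    using VT_SS_imp_D3mC[OF P] by blast
  have e: "VT r \<and> FT r \<longrightarrow> D3mC r \<and> D3MF r"
    using VT_FT_imp_D3mC[OF P] FT_imp_D3MF by blast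
  have f: "D3mC r \<and> UT r \<longrightarrow> DAI r"
    using D3mC_UT_imp_DAI by blast
  have g: "D3mC r \<and> NCC r \<longrightarrow> UT r \<and> DAI r \<and> UC3 r"
    using D3mC_NCC_imp by blast
  have h: "D3mC r \<and> D3MD r \<and> NTC r \<longrightarrow> NCC r \<and> UT r \<and> DAI r \<and> UC3 r"
    using D3mC_D3MD_NTC_imp_NCC[OF P] g by blast
  have i: "D3MF r \<and> NCC r \<longrightarrow> D3MD r"
    using D3MF_NCC_imp_D3MD by blast
  have j: "D3MF r \<and> DAI r \<longrightarrow> FT r"
    using D3MF_DAI_imp_FT by blast
  have k: "D3mCF r \<and> UC3 r \<longrightarrow> D3mC r \<and> D3MF r"
    using D3mCF_imp_D3mC D3mCF_UC3_imp_D3MF by blast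
  \<comment> \<open>Through \<open>D3mC\<close>, (g) yields \<open>UC3\<close> and
    \<open>DAI\<close>; then (k) yields \<open>D3MF\<close>, from which (i) and (j) give
    \<open>D3MD\<close> and \<open>FT\<close>.\<close>
  have l: "D3mCF r \<and> NCC r \<longrightarrow> D3MF r \<and> D3MD r \<and> D3mC r \<and> UT r \<and> DAI r \<and> UC3 r \<and> FT r"
    using D3mCF_imp_D3mC g i j k by blast
  have m: "D3mCF r \<and> D3MD r \<longrightarrow> NCC r \<and> D3MF r \<and> D3mC r \<and> UT r \<and> DAI r \<and> UC3 r \<and> FT r"
    using D3mCF_D3MD_imp_NCC[OF P] l by blast
  have n: "D3mC r \<and> D3MF r \<and> NCC r \<longrightarrow> VT r \<and> FT r \<and> UT r \<and> DAI r \<and> UC3 r \<and> D3MD r"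
    using D3mC_imp_VT g i j by blast
  have o: "VT r \<longrightarrow> UPUE r"
    using VT_imp_UPUE[OF P] by blast
  show ?thesis
    by (intro conjI a b c d e f g h i j k l m n o)
qed

end
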